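(* Let $\Delta$ be a finite simplicial complex and let $\tau:\Delta\to\Delta$ be an involution of $\Delta$. Suppose that the fixed point set $\Delta^{\tau}=\{\sigma\in\Delta:\tau(\sigma)=\sigma\}$ is itself a simplicial complex (equivalently, no simplex of $\Delta$ fixed by $\tau$ contains two distinct vertices that are interchanged by $\tau$). Then $g(\Delta)=g(\Delta^{\tau})$, where $g$ denotes the nim-value in the game of subset take-away.
   Context: A (finite) simplicial complex $\Delta$ on a finite vertex set $V$ is a collection of nonempty subsets of $V$ such that whenever $\sigma\in\Delta$ and $\emptyset\neq\varphi\subseteq\sigma$, also $\varphi\in\Delta$. Subset take-away on $\Delta$ is the impartial two-player game in which players alternate; a move consists of choosing some $\sigma$ in the current complex and deleting $\sigma$ together with every element of the current complex that contains $\sigma$; the resulting position is again a simplicial complex. The player who makes the last move wins. The nim-value $g$ of a position is defined recursively: $g(\emptyset)=0$, and $g(\Delta)$ is the minimal nonnegative integer not equal to $g$ of any position reachable from $\Delta$ in one move. An involution of $\Delta$ is a map $\tau:\Delta\to\Delta$ such that (1) $\tau$ restricted to the vertices (singletons) of $\Delta$ is a permutation with $\tau^2(A)=A$ for every vertex $A$, and (2) for $\sigma=\{\sigma_1,\dots,\sigma_k\}$, one has $\sigma\in\Delta$ if and only if $\tau(\sigma)=\{\tau(\sigma_1),\dots,\tau(\sigma_k)\}\in\Delta$ (here vertices are identified with elements of $V$). *)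

theory Defs
  imports Main "HOL-Library.FuncSet"
begin

definition simplicial_complex :: "'a set \<Rightarrow> 'a set set \<Rightarrow> bool" where
  "simplicial_complex V \<Delta> \<longleftrightarrow>
     finite V \<and> (\<forall>\<sigma>\<in>\<Delta>. \<sigma> \<noteq> {} \<and> \<sigma> \<subseteq> V) \<and>
     (\<forall>\<sigma>\<in>\<Delta>. \<forall>\<phi>. \<phi> \<noteq> {} \<and> \<phi> \<subseteq> \<sigma> \<longrightarrow> \<phi> \<in> \<Delta>)"

definition vertices :: "'a set set \<Rightarrow> 'a set set" where
  "vertices \<Delta> = {A \<in> \<Delta>. is_singleton A}"

definition take_away :: "'a set set \<Rightarrow> 'a set \<Rightarrow> 'a set set" where
  "take_away \<Delta> \<sigma> = {\<rho> \<in> \<Delta>. \<not> \<sigma> \<subseteq> \<rho>}"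

lemma simplicial_complex_take_away:
  assumes "simplicial_complex V \<Delta>"
  shows "simplicial_complex V (take_away \<Delta> \<sigma>)"
  using assms unfolding simplicial_complex_def take_away_def by blast

lemma simplicial_complex_finite:
  assumes "simplicial_complex V \<Delta>"
  shows "finite \<Delta>"
proof -
  have "\<Delta> \<subseteq> Pow V" and "finite V"
    using assms by (auto simp: simplicial_complex_def)
  then show ?thesis
    by (simp add: finite_subset)
qed

definition mex :: "nat set \<Rightarrow> nat" where
  "mex S = (LEAST n. n \<notin> S)"

text \<open>Infinite families of sets are not positions of the game; the value 0 given to them
  below is a dummy that makes the recursion total.\<close>

function nim_value :: "'a set set \<Rightarrow> nat" where
  "nim_value \<Delta> =
     (if finite \<Delta> then mex ((\<lambda>\<sigma>. nim_value (take_away \<Delta> \<sigma>)) ` \<Delta>) else 0)"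
  by pat_completeness simp
termination
proof (relation "measure card")
  fix \<Delta> :: "'a set set" and \<sigma>
  assume "finite \<Delta>" and "\<sigma> \<in> \<Delta>"
  then have "card (take_away \<Delta> \<sigma>) < card \<Delta>"
    by (intro psubset_card_mono) (auto simp: take_away_def)
  then show "(take_away \<Delta> \<sigma>, \<Delta>) \<in> measure card"
    by simp
qed simp

declare nim_value.simps [simp del]

lemma nim_value_empty: "nim_value {} = 0"
  by (subst nim_value.simps) (simp add: mex_def)

text \<open>The action of \<open>\<tau>\<close> on elements of the ground set, under the identification of a
  vertex \<open>{v}\<close> of the complex with \<open>v\<close>. It is meaningful only where \<open>{v}\<close> is a vertex
  that \<open>\<tau>\<close> maps to a vertex.\<close>

definition on_points :: "('a set \<Rightarrow> 'a set) \<Rightarrow> 'a \<Rightarrow> 'a" where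
  "on_points \<tau> v = the_elem (\<tau> {v})"

text \<open>The last conjunct ranges over all sets of vertices of \<open>\<Delta>\<close>, whether or not they are
  simplices; the values of \<open>\<tau>\<close> outside \<open>\<Delta>\<close> play no role.\<close>

definition is_involution :: "'a set set \<Rightarrow> ('a set \<Rightarrow> 'a set) \<Rightarrow> bool" where
  "is_involution \<Delta> \<tau> \<longleftrightarrow>
     \<tau> \<in> \<Delta> \<rightarrow> \<Delta> \<and>
     bij_betw \<tau> (vertices \<Delta>) (vertices \<Delta>) \<and>
     (\<forall>A\<in>vertices \<Delta>. \<tau> (\<tau> A) = A) \<and>
     (\<forall>\<sigma>\<in>\<Delta>. \<tau> \<sigma> = on_points \<tau> ` \<sigma>) \<and>
     (\<forall>\<sigma>. \<sigma> \<subseteq> \<Union>(vertices \<Delta>) \<longrightarrow> (\<sigma> \<in> \<Delta> \<longleftrightarrow> on_points \<tau> ` \<sigma> \<in> \<Delta>))"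

definition fixed_simplices :: "'a set set \<Rightarrow> ('a set \<Rightarrow> 'a set) \<Rightarrow> 'a set set" where
  "fixed_simplices \<Delta> \<tau> = {\<sigma> \<in> \<Delta>. \<tau> \<sigma> = \<sigma>}"

end

(* Induction on the size of the complex.  A move at a fixed simplex is available in both complexes
   and commutes with passing to fixed points.  A move at a simplex that is not fixed can be answered
   by its mirror image, and the pair of moves leaves the fixed complex untouched because that
   complex is closed under faces; hence such a move never leads to the nim-value of the fixed
   complex.  Only the inclusion order matters, so the argument is carried out for order
   automorphisms of order two of a finite family of sets. *)

theory Submission
  imports Defs
begin

lemma mex_notin:
  assumes "finite S"
  shows "mex S \<notin> S"
  unfolding mex_def using ex_new_if_finite[OF infinite_UNIV_nat assms] by (rule LeastI_ex)

lemma less_mex_in: "n < mex S \<Longrightarrow> n \<in> S"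
  unfolding mex_def using not_less_Least by blast

lemma mex_eqI:
  assumes "n \<notin> S" and "\<And>m. m < n \<Longrightarrow> m \<in> S"
  shows "mex S = n"
  unfolding mex_def using assms by (intro Least_equality) (auto simp: not_less[symmetric])

lemma nim_value_eq_mex:
  "finite \<Delta> \<Longrightarrow> nim_value \<Delta> = mex ((\<lambda>\<sigma>. nim_value (take_away \<Delta> \<sigma>)) ` \<Delta>)"
  by (subst nim_value.simps) simp

text \<open>The mex of a finite set lies outside it. This is used twice: on the fixed complex for
  moves at fixed simplices, and on the position after any other move, which has the mirror reply as
  an option.\<close>

lemma nim_value_take_away_neq:
  assumes "finite \<Delta>" and "\<sigma> \<in> \<Delta>"
  shows "nim_value (take_away \<Delta> \<sigma>) \<noteq> nim_value \<Delta>"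
  using assms mex_notin[of "(\<lambda>\<sigma>. nim_value (take_away \<Delta> \<sigma>)) ` \<Delta>"]
  by (metis finite_imageI imageI nim_value_eq_mex)

lemma nim_value_less_take_away:
  assumes "finite \<Delta>" and "n < nim_value \<Delta>"
  obtains \<sigma> where "\<sigma> \<in> \<Delta>" and "n = nim_value (take_away \<Delta> \<sigma>)"
  using assms less_mex_in[of n "(\<lambda>\<sigma>. nim_value (take_away \<Delta> \<sigma>)) ` \<Delta>"]
  by (auto simp: nim_value_eq_mex)

lemma nim_value_eqI:
  assumes "finite \<Delta>"
    and "\<And>\<sigma>. \<sigma> \<in> \<Delta> \<Longrightarrow> nim_value (take_away \<Delta> \<sigma>) \<noteq> n"
    and "\<And>m. m < n \<Longrightarrow> \<exists>\<sigma>\<in>\<Delta>. nim_value (take_away \<Delta> \<sigma>) = m"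
  shows "nim_value \<Delta> = n"
  unfolding nim_value_eq_mex[OF assms(1)] by (rule mex_eqI) (use assms(2,3) in fastforce)+

lemma take_away_subset: "take_away \<Delta> \<sigma> \<subseteq> \<Delta>"
  by (auto simp: take_away_def)

lemma take_away_psubset: "\<sigma> \<in> \<Delta> \<Longrightarrow> take_away \<Delta> \<sigma> \<subset> \<Delta>"
  by (auto simp: take_away_def)

text \<open>Both operations filter the family by a condition on single members, so they
  commute.\<close>

lemma fixed_simplices_take_away:
  "fixed_simplices (take_away \<Delta> \<sigma>) \<tau> = take_away (fixed_simplices \<Delta> \<tau>) \<sigma>"
  by (auto simp: take_away_def fixed_simplices_def)

text \<open>The hypotheses speak only of members and their inclusions. Apart from invariance under
  \<open>\<tau>\<close> they pass to every subfamily, so the induction has to check just invariance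
  of the new position. The last one says that the fixed members are closed under faces within the
  family.\<close>

lemma nim_value_fixed_simplices:
  assumes "finite \<Delta>"
    and "\<And>\<sigma>. \<sigma> \<in> \<Delta> \<Longrightarrow> \<tau> \<sigma> \<in> \<Delta>"
    and "\<And>\<sigma>. \<sigma> \<in> \<Delta> \<Longrightarrow> \<tau> (\<tau> \<sigma>) = \<sigma>"
    and "\<And>\<sigma> \<rho>. \<sigma> \<in> \<Delta> \<Longrightarrow> \<rho> \<in> \<Delta> \<Longrightarrow> \<sigma> \<subseteq> \<rho> \<Longrightarrow> \<tau> \<sigma> \<subseteq> \<tau> \<rho>"
    and "\<And>\<sigma> \<rho>. \<sigma> \<in> \<Delta> \<Longrightarrow> \<rho> \<in> \<Delta> \<Longrightarrow> \<sigma> \<subseteq> \<rho> \<Longrightarrow> \<tau> \<rho> = \<rho> \<Longrightarrow> \<tau> \<sigma> = \<sigma>"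
  shows "nim_value \<Delta> = nim_value (fixed_simplices \<Delta> \<tau>)"
  using assms
proof (induction \<Delta> rule: finite_psubset_induct)
  case (psubset \<Delta>)
  note inv = psubset.prems(1) and invol = psubset.prems(2) and mono = psubset.prems(3)
    and face = psubset.prems(4)
  have IH: "nim_value \<Gamma> = nim_value (fixed_simplices \<Gamma> \<tau>)"
    if \<Gamma>: "\<Gamma> \<subset> \<Delta>" "\<And>\<rho>. \<rho> \<in> \<Gamma> \<Longrightarrow> \<tau> \<rho> \<in> \<Gamma>" for \<Gamma>
  proof (rule psubset.IH[OF \<Gamma>])
    have sub: "\<sigma> \<in> \<Delta>" if "\<sigma> \<in> \<Gamma>" for \<sigma> using that \<Gamma>(1) by blast
    show "\<tau> (\<tau> \<sigma>) = \<sigma>" if "\<sigma> \<in> \<Gamma>" for \<sigma>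
      using invol[OF sub[OF that]] .
    show "\<tau> \<sigma> \<subseteq> \<tau> \<rho>" if "\<sigma> \<in> \<Gamma>" "\<rho> \<in> \<Gamma>" "\<sigma> \<subseteq> \<rho>" for \<sigma> \<rho>
      using mono[OF sub sub] that .
    show "\<tau> \<sigma> = \<sigma>" if "\<sigma> \<in> \<Gamma>" "\<rho> \<in> \<Gamma>" "\<sigma> \<subseteq> \<rho>" "\<tau> \<rho> = \<rho>" for \<sigma> \<rho>
      using face[OF sub sub] that .
  qed
  have fin: "finite (fixed_simplices \<Delta> \<tau>)"
    using psubset.hyps by (simp add: fixed_simplices_def)
  have fixed_move: "nim_value (take_away \<Delta> \<sigma>) = nim_value (take_away (fixed_simplices \<Delta> \<tau>) \<sigma>)"
    if \<sigma>: "\<sigma> \<in> fixed_simplices \<Delta> \<tau>" for \<sigma>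
  proof -
    have "\<sigma> \<in> \<Delta>" "\<tau> \<sigma> = \<sigma>" using \<sigma> by (auto simp: fixed_simplices_def)
    \<comment> \<open>If \<open>\<sigma> \<subseteq> \<tau> \<rho>\<close>, applying
      \<open>\<tau>\<close> gives \<open>\<sigma> \<subseteq> \<rho>\<close>, because
      \<open>\<sigma>\<close> is fixed; so the position after the move is again invariant.\<close>
    then have "\<tau> \<rho> \<in> take_away \<Delta> \<sigma>" if "\<rho> \<in> take_away \<Delta> \<sigma>" for \<rho>
      using that inv[of \<rho>] invol[of \<rho>] mono[of \<sigma> "\<tau> \<rho>"] by (auto simp: take_away_def)
    then show ?thesis
      using IH[of "take_away \<Delta> \<sigma>"] take_away_psubset[OF \<open>\<sigma> \<in> \<Delta>\<close>]
      by (simp add: fixed_simplices_take_away)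
  qed
  show ?case
  \<comment> \<open>Every value below that of the fixed family must be reached, and that value
    itself must be avoided.\<close>
  proof (rule nim_value_eqI[OF psubset.hyps])
    fix m assume "m < nim_value (fixed_simplices \<Delta> \<tau>)"
    then obtain \<sigma> where "\<sigma> \<in> fixed_simplices \<Delta> \<tau>"
      and "m = nim_value (take_away (fixed_simplices \<Delta> \<tau>) \<sigma>)"
      using nim_value_less_take_away[OF fin] by blast
    then show "\<exists>\<sigma>\<in>\<Delta>. nim_value (take_away \<Delta> \<sigma>) = m"
      using fixed_move by (auto simp: fixed_simplices_def)
  next
    fix \<sigma> assume \<sigma>: "\<sigma> \<in> \<Delta>"
    show "nim_value (take_away \<Delta> \<sigma>) \<noteq> nim_value (fixed_simplices \<Delta> \<tau>)"
    proof (cases "\<tau> \<sigma> = \<sigma>")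
      case True
      with \<sigma> have "\<sigma> \<in> fixed_simplices \<Delta> \<tau>" by (simp add: fixed_simplices_def)
      then show ?thesis using fixed_move nim_value_take_away_neq[OF fin] by simp
    next
      case False
      \<comment> \<open>The position after the move at \<open>\<sigma>\<close> and the mirror reply
        at \<open>\<tau> \<sigma>\<close>.\<close>
      define \<Gamma> where "\<Gamma> = take_away (take_away \<Delta> \<sigma>) (\<tau> \<sigma>)"
      \<comment> \<open>The reply is legal: from
        \<open>\<sigma> \<subseteq> \<tau> \<sigma>\<close>, applying \<open>\<tau>\<close> would
        give the reverse inclusion, and \<open>\<sigma>\<close> would be fixed.\<close>
      have "\<not> \<sigma> \<subseteq> \<tau> \<sigma>"
        using False mono[OF \<sigma> inv[OF \<sigma>]] invol[OF \<sigma>] by auto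
      then have reply: "\<tau> \<sigma> \<in> take_away \<Delta> \<sigma>"
        using inv[OF \<sigma>] by (simp add: take_away_def)
      \<comment> \<open>Applying \<open>\<tau>\<close> exchanges the two deletion conditions:
        \<open>\<sigma> \<subseteq> \<tau> \<rho>\<close> gives
        \<open>\<tau> \<sigma> \<subseteq> \<rho>\<close>, and
        \<open>\<tau> \<sigma> \<subseteq> \<tau> \<rho>\<close> gives
        \<open>\<sigma> \<subseteq> \<rho>\<close>.\<close>
      have "\<tau> \<rho> \<in> \<Gamma>" if "\<rho> \<in> \<Gamma>" for \<rho>
        using that inv[of \<rho>] invol[of \<rho>] invol[OF \<sigma>] mono[OF \<sigma>, of "\<tau> \<rho>"]
          mono[OF inv[OF \<sigma>], of "\<tau> \<rho>"]
        by (auto simp: \<Gamma>_def take_away_def)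
      moreover have "\<Gamma> \<subset> \<Delta>"
        using take_away_psubset[OF \<sigma>] take_away_psubset[OF reply] unfolding \<Gamma>_def by blast
      ultimately have "nim_value \<Gamma> = nim_value (fixed_simplices \<Gamma> \<tau>)"
        by (rule IH[rotated])
      \<comment> \<open>A fixed member containing \<open>\<sigma>\<close> or
        \<open>\<tau> \<sigma>\<close> would force that set to be fixed as well; either case yields
        \<open>\<tau> \<sigma> = \<sigma>\<close>. So the two moves delete no fixed member.\<close>
      moreover have "fixed_simplices \<Gamma> \<tau> = fixed_simplices \<Delta> \<tau>"
        using face[OF \<sigma>] face[OF inv[OF \<sigma>]] False invol[OF \<sigma>]
        by (auto simp: \<Gamma>_def fixed_simplices_def take_away_def)
      \<comment> \<open>\<open>\<Gamma>\<close> is an option of the position after the first move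
        and has the value of the fixed family, so that position cannot have this value.\<close>
      moreover have "nim_value \<Gamma> \<noteq> nim_value (take_away \<Delta> \<sigma>)"
        unfolding \<Gamma>_def using psubset.hyps reply
        by (intro nim_value_take_away_neq) (auto intro: finite_subset[OF take_away_subset])
      ultimately show ?thesis by simp
    qed
  qed
qed

lemma simplicial_complex_face:
  "simplicial_complex V \<Delta> \<Longrightarrow> \<sigma> \<in> \<Delta> \<Longrightarrow> \<phi> \<noteq> {} \<Longrightarrow> \<phi> \<subseteq> \<sigma> \<Longrightarrow> \<phi> \<in> \<Delta>"
  unfolding simplicial_complex_def by blast

lemma simplicial_complex_subset:
  assumes "simplicial_complex V \<Delta>" and "\<Gamma> \<subseteq> \<Delta>"
    and "\<And>\<sigma> \<phi>. \<sigma> \<in> \<Gamma> \<Longrightarrow> \<phi> \<noteq> {} \<Longrightarrow> \<phi> \<subseteq> \<sigma> \<Longrightarrow> \<phi> \<in> \<Gamma>"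
  shows "simplicial_complex V \<Gamma>"
  unfolding simplicial_complex_def
proof (intro conjI ballI allI impI)
  show "finite V" using assms(1) by (simp add: simplicial_complex_def)
  show "\<sigma> \<noteq> {}" "\<sigma> \<subseteq> V" if "\<sigma> \<in> \<Gamma>" for \<sigma>
    using assms(1,2) that unfolding simplicial_complex_def by auto
qed (use assms(3) in blast)

lemma simplicial_complex_vertex:
  "simplicial_complex V \<Delta> \<Longrightarrow> \<sigma> \<in> \<Delta> \<Longrightarrow> v \<in> \<sigma> \<Longrightarrow> {v} \<in> vertices \<Delta>"
  unfolding simplicial_complex_def vertices_def is_singleton_def by blast

lemma involution_in: "is_involution \<Delta> \<tau> \<Longrightarrow> \<sigma> \<in> \<Delta> \<Longrightarrow> \<tau> \<sigma> \<in> \<Delta>"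
  unfolding is_involution_def by (elim conjE funcset_mem)

lemma involution_eq_image: "is_involution \<Delta> \<tau> \<Longrightarrow> \<sigma> \<in> \<Delta> \<Longrightarrow> \<tau> \<sigma> = on_points \<tau> ` \<sigma>"
  unfolding is_involution_def by (elim conjE) (rule bspec)

text \<open>Makes the identification of \<open>{v}\<close> with \<open>v\<close> usable: claims
  about simplices can now be checked point by point.\<close>

lemma involution_vertex:
  assumes "is_involution \<Delta> \<tau>" and "{v} \<in> vertices \<Delta>"
  shows "\<tau> {v} = {on_points \<tau> v}" and "{on_points \<tau> v} \<in> vertices \<Delta>"
    and "on_points \<tau> (on_points \<tau> v) = v"
proof -
  show eq: "\<tau> {v} = {on_points \<tau> v}"
    using assms involution_eq_image[of \<Delta> \<tau> "{v}"] by (simp add: vertices_def)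
  then show "{on_points \<tau> v} \<in> vertices \<Delta>"
    using assms unfolding is_involution_def by (metis bij_betwE)
  have "\<tau> (\<tau> {v}) = {v}"
    using assms unfolding is_involution_def by (elim conjE) (rule bspec)
  then show "on_points \<tau> (on_points \<tau> v) = v"
    unfolding eq by (simp add: on_points_def)
qed

text \<open>The definition asks for order two on vertices only. It extends to simplices because
  \<open>\<tau>\<close> acts on a simplex through its points, each of which is a vertex.\<close>

lemma involution_involutive:
  assumes "simplicial_complex V \<Delta>" and "is_involution \<Delta> \<tau>" and "\<sigma> \<in> \<Delta>"
  shows "\<tau> (\<tau> \<sigma>) = \<sigma>"
proof -
  have "on_points \<tau> (on_points \<tau> v) = v" if "v \<in> \<sigma>" for v
    using involution_vertex(3)[OF assms(2)] simplicial_complex_vertex[OF assms(1,3) that] .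
  then have "on_points \<tau> ` on_points \<tau> ` \<sigma> = \<sigma>"
    by (force simp: image_image)
  then show ?thesis
    using involution_eq_image[OF assms(2,3)]
      involution_eq_image[OF assms(2) involution_in[OF assms(2,3)]] by metis
qed

text \<open>If the fixed simplices form a complex, each vertex of a fixed simplex is a face of it
  and hence fixed, so no two are interchanged. Conversely, without interchanged pairs
  \<open>\<tau>\<close> fixes a fixed simplex point by point, and therefore all its faces.\<close>

lemma simplicial_complex_fixed_simplices_iff:
  assumes "simplicial_complex V \<Delta>" and "is_involution \<Delta> \<tau>"
  shows "simplicial_complex V (fixed_simplices \<Delta> \<tau>) \<longleftrightarrow>
           \<not> (\<exists>\<sigma>\<in>\<Delta>. \<tau> \<sigma> = \<sigma> \<and>
               (\<exists>v\<in>\<sigma>. \<exists>w\<in>\<sigma>. v \<noteq> w \<and> \<tau> {v} = {w} \<and> \<tau> {w} = {v}))"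
    (is "?L \<longleftrightarrow> \<not> ?R")
proof
  assume ?L
  then have "\<tau> {v} = {v}" if "\<sigma> \<in> \<Delta>" "\<tau> \<sigma> = \<sigma>" "v \<in> \<sigma>" for \<sigma> v
    using that simplicial_complex_vertex[of V "fixed_simplices \<Delta> \<tau>" \<sigma> v]
    by (simp add: fixed_simplices_def vertices_def)
  then show "\<not> ?R" by (metis singleton_inject)
next
  assume no_swap: "\<not> ?R"
  have act: "\<tau> \<sigma> = on_points \<tau> ` \<sigma>" if "\<sigma> \<in> \<Delta>" for \<sigma>
    using involution_eq_image[OF assms(2) that] .
  note face = simplicial_complex_face[OF assms(1)]
  \<comment> \<open>Otherwise \<open>v\<close> and \<open>on_points \<tau> v\<close> are an excluded
    pair: the image lies in \<open>\<sigma>\<close> because \<open>\<sigma>\<close> is fixed, and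
    order two sends it back to \<open>v\<close>.\<close>
  have fixed_point: "on_points \<tau> v = v" if "\<sigma> \<in> \<Delta>" "\<tau> \<sigma> = \<sigma>" "v \<in> \<sigma>" for \<sigma> v
  proof (rule ccontr)
    assume "on_points \<tau> v \<noteq> v"
    moreover have v: "{v} \<in> vertices \<Delta>"
      using simplicial_complex_vertex[OF assms(1)] that by blast
    moreover have "on_points \<tau> v \<in> \<sigma>"
      using act[OF that(1)] that(2,3) by (metis imageI)
    moreover have "\<tau> {v} = {on_points \<tau> v}"
      using involution_vertex(1)[OF assms(2) v] .
    moreover have "\<tau> {on_points \<tau> v} = {v}"
      using involution_vertex(1)[OF assms(2) involution_vertex(2)[OF assms(2) v]]
      by (simp only: involution_vertex(3)[OF assms(2) v])
    ultimately show False using no_swap that by metis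
  qed
  have fixed_face: "\<tau> \<phi> = \<phi>" if "\<sigma> \<in> \<Delta>" "\<tau> \<sigma> = \<sigma>" "\<phi> \<noteq> {}" "\<phi> \<subseteq> \<sigma>" for \<sigma> \<phi>
  proof -
    have "on_points \<tau> ` \<phi> = (\<lambda>v. v) ` \<phi>"
      by (rule image_cong) (use fixed_point that in auto)
    then show ?thesis using act[OF face[OF that(1,3,4)]] by simp
  qed
  show ?L
  proof (rule simplicial_complex_subset[OF assms(1)])
    show "\<phi> \<in> fixed_simplices \<Delta> \<tau>"
      if "\<sigma> \<in> fixed_simplices \<Delta> \<tau>" "\<phi> \<noteq> {}" "\<phi> \<subseteq> \<sigma>" for \<sigma> \<phi>
      using that face fixed_face unfolding fixed_simplices_def by blast
  qed (auto simp: fixed_simplices_def)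
qed

theorem theorem1:
  fixes V :: "'a set" and \<Delta> :: "'a set set" and \<tau> :: "'a set \<Rightarrow> 'a set"
  assumes "simplicial_complex V \<Delta>"
    and "is_involution \<Delta> \<tau>"
  shows "(simplicial_complex V (fixed_simplices \<Delta> \<tau>) \<longleftrightarrow>
           \<not> (\<exists>\<sigma>\<in>\<Delta>. \<tau> \<sigma> = \<sigma> \<and>
               (\<exists>v\<in>\<sigma>. \<exists>w\<in>\<sigma>. v \<noteq> w \<and> \<tau> {v} = {w} \<and> \<tau> {w} = {v}))) \<and>
         (simplicial_complex V (fixed_simplices \<Delta> \<tau>) \<longrightarrow>
           nim_value \<Delta> = nim_value (fixed_simplices \<Delta> \<tau>))"
proof (intro conjI impI)
  assume fixed: "simplicial_complex V (fixed_simplices \<Delta> \<tau>)"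
  show "nim_value \<Delta> = nim_value (fixed_simplices \<Delta> \<tau>)"
  proof (rule nim_value_fixed_simplices)
    show "finite \<Delta>" using assms(1) by (rule simplicial_complex_finite)
    show "\<tau> \<sigma> \<in> \<Delta>" if "\<sigma> \<in> \<Delta>" for \<sigma>
      using involution_in[OF assms(2) that] .
    show "\<tau> (\<tau> \<sigma>) = \<sigma>" if "\<sigma> \<in> \<Delta>" for \<sigma>
      using involution_involutive[OF assms that] .
    show "\<tau> \<sigma> \<subseteq> \<tau> \<rho>" if "\<sigma> \<in> \<Delta>" "\<rho> \<in> \<Delta>" "\<sigma> \<subseteq> \<rho>" for \<sigma> \<rho>
      using that by (simp add: involution_eq_image[OF assms(2)] image_mono)
    \<comment> \<open>Here the assumption on the fixed simplices enters: \<open>\<sigma>\<close> is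
      a nonempty face of the fixed simplex \<open>\<rho>\<close>, so it belongs to the fixed
      complex.\<close>
    show "\<tau> \<sigma> = \<sigma>" if "\<sigma> \<in> \<Delta>" "\<rho> \<in> \<Delta>" "\<sigma> \<subseteq> \<rho>" "\<tau> \<rho> = \<rho>" for \<sigma> \<rho>
    proof -
      have "\<sigma> \<noteq> {}" using assms(1) that(1) unfolding simplicial_complex_def by blast
      moreover have "\<rho> \<in> fixed_simplices \<Delta> \<tau>" using that by (simp add: fixed_simplices_def)
      ultimately have "\<sigma> \<in> fixed_simplices \<Delta> \<tau>"
        using simplicial_complex_face[OF fixed] that(3) by blast
      then show ?thesis by (simp add: fixed_simplices_def)
    qed
  qed
qed (rule simplicial_complex_fixed_simplices_iff[OF assms])

end
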